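(* Let $G=[V,E]$ be a finite simple undirected graph (not necessarily planar) with vertex weights $x(v)$, $v\in V$, and symmetric edge weights $a(v,v')=a(v',v)$, $(v,v')\in E$, and let $\mathcal{O}$ be an arbitrary orientation of the edges of $G$. Let $Z_{G,\mathcal{O}}$ be the signed partition function of the loop-vertex model on $(G,\mathcal{O})$ and let $K$ be the signed adjacency matrix of $(G,\mathcal{O})$. Then $$Z_{G,\mathcal{O}}=\det K .$$
   Context: The weights $x(v)$ and $a(v,v')$ are commuting indeterminates (or arbitrary real numbers). An orientation $\mathcal{O}$ is a choice of a direction for each edge. Loop-vertex configuration: a collection $C$ of pairwise vertex-disjoint directed loops of even length in $G$, where a loop of length $2$ is a doubled edge (there is exactly one such loop for each edge) and a loop of length $2k\ge 4$ is a directed simple cycle (so each undirected cycle gives two distinct directed loops). Every vertex is thus either isolated (in no loop) or belongs to exactly one loop. $\mathcal{L}$ denotes the set of all loop-vertex configurations (including the one with no loops). Weights: for an edge $(v_1,v_2)$ put $\operatorname{sgn}(v_1,v_2)=+1$ if $\mathcal{O}$ directs the edge from $v_1$ to $v_2$, and $-1$ otherwise. For a directed even loop $\ell=(v_1,\dots,v_{2k},v_1)$, with $v_{2k+1}=v_1$, $$w(\ell)=-\prod_{j=1}^{2k}\operatorname{sgn}(v_j,v_{j+1})\,a(v_j,v_{j+1}).$$ (So a doubled edge has weight $+a(v_1,v_2)^2$.) For $C\in\mathcal{L}$, $$w(C)=\prod_{\ell\text{ a loop of }C}w(\ell)\prod_{v\text{ isolated in }C}x(v),\qquad Z_{G,\mathcal{O}}=\sum_{C\in\mathcal{L}}w(C).$$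 Signed adjacency matrix: $K$ is indexed by $V$, with $K(v,v)=x(v)$; $K(v,v')=a(v,v')$ if $(v,v')\in E$ is directed from $v$ to $v'$ in $\mathcal{O}$; $K(v,v')=-a(v,v')$ if it is directed from $v'$ to $v$; and $K(v,v')=0$ if $v\neq v'$ are not adjacent. *)

theory Defs
  imports "HOL-Analysis.Analysis"
begin

text \<open>
  The vertex set \<open>V\<close> is the universe of a finite type \<open>'v\<close>, edges are two-element sets of vertices,
  and weights live in an arbitrary commutative ring, which covers real numbers as well as
  commuting indeterminates.
\<close>

definition simple_graph :: "'v set set \<Rightarrow> bool" where
  "simple_graph E \<longleftrightarrow> (\<forall>e\<in>E. card e = 2)"

text \<open>An orientation is given by its set of arcs: \<open>(u, v) \<in> D\<close> means that the edge \<open>{u, v}\<close> is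
  directed from \<open>u\<close> to \<open>v\<close>.\<close>

definition orientation :: "'v set set \<Rightarrow> ('v \<times> 'v) set \<Rightarrow> bool" where
  "orientation E D \<longleftrightarrow>
     (\<forall>(u, v)\<in>D. {u, v} \<in> E) \<and>
     (\<forall>u v. {u, v} \<in> E \<longrightarrow> ((u, v) \<in> D \<longleftrightarrow> (v, u) \<notin> D))"

text \<open>
  A directed loop \<open>(v\<^sub>1, \<dots>, v\<^sub>m, v\<^sub>1)\<close> is represented by the set of its arcs
  \<open>(v\<^sub>j, v\<^sub>j\<^sub>+\<^sub>1)\<close>. This forgets exactly the choice of the starting vertex: the two directions of
  a cycle of length at least 3 have different arc sets, whereas an edge \<open>{u, v}\<close> gives the
  single doubled edge \<open>{(u, v), (v, u)}\<close>.
\<close>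

definition loop_arcs :: "'v list \<Rightarrow> ('v \<times> 'v) set" where
  "loop_arcs vs = {(vs ! j, vs ! (Suc j mod length vs)) | j. j < length vs}"

definition even_directed_loop :: "'v set set \<Rightarrow> ('v \<times> 'v) set \<Rightarrow> bool" where
  "even_directed_loop E l \<longleftrightarrow>
     (\<exists>vs. distinct vs \<and> even (length vs) \<and> length vs \<ge> 2 \<and>
           (\<forall>j<length vs. {vs ! j, vs ! (Suc j mod length vs)} \<in> E) \<and>
           l = loop_arcs vs)"

text \<open>The vertex set of a loop \<open>l\<close> is \<open>Field l\<close>.\<close>

definition loop_vertex_configs :: "'v set set \<Rightarrow> ('v \<times> 'v) set set set" where
  "loop_vertex_configs E =
     {C. (\<forall>l\<in>C. even_directed_loop E l) \<and> pairwise (\<lambda>l m. disjnt (Field l) (Field m)) C}"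

definition isolated_vertices :: "('v \<times> 'v) set set \<Rightarrow> 'v set" where
  "isolated_vertices C = UNIV - (\<Union>l\<in>C. Field l)"

definition arc_sgn :: "('v \<times> 'v) set \<Rightarrow> 'v \<Rightarrow> 'v \<Rightarrow> 'a::comm_ring_1" where
  "arc_sgn D u v = (if (u, v) \<in> D then 1 else - 1)"

definition loop_weight ::
  "('v \<times> 'v) set \<Rightarrow> ('v \<Rightarrow> 'v \<Rightarrow> 'a::comm_ring_1) \<Rightarrow> ('v \<times> 'v) set \<Rightarrow> 'a" where
  "loop_weight D a l = - (\<Prod>(u, v)\<in>l. arc_sgn D u v * a u v)"

definition config_weight ::
  "('v \<times> 'v) set \<Rightarrow> ('v \<Rightarrow> 'a) \<Rightarrow> ('v \<Rightarrow> 'v \<Rightarrow> 'a::comm_ring_1) \<Rightarrow> ('v \<times> 'v) set set \<Rightarrow> 'a" where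
  "config_weight D x a C = (\<Prod>l\<in>C. loop_weight D a l) * (\<Prod>v\<in>isolated_vertices C. x v)"

definition signed_partition_function ::
  "'v set set \<Rightarrow> ('v \<times> 'v) set \<Rightarrow> ('v::finite \<Rightarrow> 'a) \<Rightarrow> ('v \<Rightarrow> 'v \<Rightarrow> 'a::comm_ring_1) \<Rightarrow> 'a" where
  "signed_partition_function E D x a = (\<Sum>C\<in>loop_vertex_configs E. config_weight D x a C)"

definition signed_adjacency_matrix ::
  "'v set set \<Rightarrow> ('v \<times> 'v) set \<Rightarrow> ('v::finite \<Rightarrow> 'a) \<Rightarrow> ('v \<Rightarrow> 'v \<Rightarrow> 'a::comm_ring_1) \<Rightarrow> 'a^'v^'v" where
  "signed_adjacency_matrix E D x a =
     (\<chi> u v. if u = v then x u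
            else if {u, v} \<in> E \<and> (u, v) \<in> D then a u v
            else if {u, v} \<in> E \<and> (v, u) \<in> D then - a u v
            else 0)"

text \<open>The product over the arcs in \<^const>\<open>loop_weight\<close> is the product along any vertex sequence
  tracing out the loop, and \<^const>\<open>Field\<close> gives the vertices of that sequence.\<close>

lemma loop_weight_loop_arcs:
  assumes "distinct vs"
  shows "loop_weight D a (loop_arcs vs) =
    - (\<Prod>j<length vs. arc_sgn D (vs ! j) (vs ! (Suc j mod length vs)) *
                      a (vs ! j) (vs ! (Suc j mod length vs)))"
proof -
  let ?f = "\<lambda>j. (vs ! j, vs ! (Suc j mod length vs))"
  have arcs: "loop_arcs vs = ?f ` {..<length vs}"
    by (auto simp: loop_arcs_def)
  have "inj_on ?f {..<length vs}"
    using assms by (auto simp: inj_on_def nth_eq_iff_index_eq)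
  then show ?thesis
    by (simp add: loop_weight_def arcs prod.reindex)
qed

lemma Field_loop_arcs: "Field (loop_arcs vs) = set vs"
proof
  show "Field (loop_arcs vs) \<subseteq> set vs"
    by (auto simp: Field_def loop_arcs_def)
       (metis length_pos_if_in_set mod_less_divisor nth_mem)
  show "set vs \<subseteq> Field (loop_arcs vs)"
    by (force simp: Field_def loop_arcs_def in_set_conv_nth)
qed

end

theory Submission
  imports Defs "HOL-Combinatorics.Cycles" "HOL-Combinatorics.Orbits"
begin

text \<open>
  In the permutation expansion of the determinant, reversing a cycle preserves the sign of the
  permutation and, since the matrix is skew-symmetric off the diagonal, multiplies the product of
  entries by \<open>- 1\<close> to the power of the cycle length. Hence the permutations having an odd cycle of
  length at least 3 cancel in pairs. The remaining ones that move vertices only along edges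
  correspond to the loop-vertex configurations, the nontrivial cycles being the loops; every cycle
  of even length contributes \<open>- 1\<close> to the sign, which is the sign in the weight of a loop.
\<close>

section \<open>Cyclic permutations and signs\<close>

lemma orbit_eq_set_support:
  assumes "permutation p"
  shows "orbit p v = set (support p v)"
  unfolding support_set[OF assms] orbit_altdef_permutation[OF assms] by (simp add: full_SetCompr_eq)

text \<open>This matches the successor convention \<open>Suc j mod length vs\<close> of
  \<open>loop_arcs\<close>: mapping the cycle over its own list rotates the list by one
  place.\<close>

lemma cycle_of_list_nth:
  assumes "distinct vs" "j < length vs"
  shows "cycle_of_list vs (vs ! j) = vs ! (Suc j mod length vs)"
proof -
  have "map (cycle_of_list vs) vs = rotate1 vs"
    using cyclic_rotation[OF assms(1), of 1] by simp
  then have "map (cycle_of_list vs) vs ! j = rotate1 vs ! j"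
    by simp
  then show ?thesis
    using assms(2) by (simp add: nth_rotate1)
qed

lemma cyclic_on_cycle_of_list:
  assumes "distinct vs" "vs \<noteq> []"
  shows "cyclic_on (cycle_of_list vs) (set vs)"
proof -
  \<comment> \<open>Below the last index the successor never wraps around, so iterating from the
    head reads off the list in order.\<close>
  have pow: "(cycle_of_list vs ^^ j) (vs ! 0) = vs ! j" if "j < length vs" for j
    using that by (induction j) (auto simp: cycle_of_list_nth[OF assms(1)])
  have "orbit (cycle_of_list vs) (vs ! 0) = set vs"
  proof
    show "orbit (cycle_of_list vs) (vs ! 0) \<subseteq> set vs"
      using assms(2) by (intro permutes_orbit_subset cycle_permutes) auto
    show "set vs \<subseteq> orbit (cycle_of_list vs) (vs ! 0)"
    proof
      fix v
      assume "v \<in> set vs"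
      then obtain j where "j < length vs" "v = vs ! j"
        by (auto simp: in_set_conv_nth)
      then show "v \<in> orbit (cycle_of_list vs) (vs ! 0)"
        using pow[of j] by (auto simp: orbit_altdef_permutation[OF permutation_of_cycle] intro: exI[of _ j])
    qed
  qed
  then show ?thesis
    using assms(2) by (intro cyclic_on_singleI[of "vs ! 0"]) auto
qed

text \<open>The list traverses the orbit of some point of \<open>S\<close>. Since \<open>c\<close>
  fixes everything outside \<open>S\<close>, it agrees with the cycle of this list everywhere and
  not just on \<open>S\<close>.\<close>

lemma cyclic_on_permutes_obtain_list:
  assumes "c permutes S" "cyclic_on c S"
  obtains vs where "distinct vs" "set vs = S" "c = cycle_of_list vs"
proof -
  have perm: "permutation c"
    using assms finite_cyclic_on permutation_permutes by blast
  obtain s where s: "s \<in> S" "S = orbit c s"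
    using assms(2) by (auto simp: cyclic_on_def)
  then have S: "set (support c s) = S"
    by (simp only: orbit_eq_set_support[OF perm])
  show thesis
  proof
    show "distinct (support c s)"
      by (rule cycle_of_permutation[OF perm])
    show "set (support c s) = S"
      by (rule S)
    show "c = cycle_of_list (support c s)"
    proof
      fix v
      show "c v = cycle_of_list (support c s) v"
      proof (cases "v \<in> S")
        case True
        then show ?thesis
          using cycle_restrict[OF perm] S by metis
      next
        case False
        then show ?thesis
          using permutes_not_in[OF assms(1)] id_outside_supp S by metis
      qed
    qed
  qed
qed

text \<open>The recursion of \<open>cycle_of_list\<close> splits off one transposition for each
  adjacent pair of the list. For the empty list, truncated subtraction gives exponent 0, the sign of
  the identity.\<close>

lemma sign_cycle_of_list:
  assumes "distinct vs"
  shows "sign (cycle_of_list vs) = (-1) ^ (length vs - 1)"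
  using assms
proof (induction vs rule: cycle_of_list.induct)
  case (1 i j cs)
  then show ?case
    by (simp add: sign_compose permutation_swap_id permutation_of_cycle sign_swap_id del: o_apply)
qed simp_all

lemma sign_cyclic_on:
  assumes "c permutes S" "cyclic_on c S"
  shows "sign c = (-1) ^ (card S - 1)"
  using cyclic_on_permutes_obtain_list[OF assms] sign_cycle_of_list distinct_card by metis

section \<open>Restricting a permutation to its orbits\<close>

lemma cyclic_on_image_eq:
  assumes "cyclic_on p S"
  shows "p ` S = S"
proof -
  have "\<exists>u\<in>S. p u = v" if "v \<in> S" for v
    using assms that by (metis cyclic_on_alldef orbit.cases)
  then show ?thesis
    using cyclic_on_inI[OF assms] by auto
qed

lemma perm_restrict_permutes:
  assumes "inj_on p S" "p ` S = S"
  shows "perm_restrict p S permutes S"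
  using assms
  by (intro bij_imp_permutes) (auto simp: perm_restrict_def bij_betw_def inj_on_def image_def)

lemma perm_restrict_cyclic_permutes:
  assumes "permutation p" "cyclic_on p S"
  shows "perm_restrict p S permutes S"
  using assms by (intro perm_restrict_permutes cyclic_on_image_eq)
    (auto intro: inj_on_subset bij_is_inj permutation_bijective)

lemma sign_perm_restrict_cyclic:
  assumes "permutation p" "cyclic_on p S"
  shows "sign (perm_restrict p S) = (-1) ^ (card S - 1)"
  using assms by (intro sign_cyclic_on perm_restrict_cyclic_permutes) (simp_all add: cyclic_on_perm_restrict)

text \<open>Restrictions to disjoint orbits compose to the restriction to their union, and
  \<open>sign\<close> is multiplicative. Working with the restriction to a union of orbits makes
  induction over the set of orbits possible.\<close>

lemma sign_perm_restrict_Union: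
  assumes "permutation p" "finite A" "\<And>S. S \<in> A \<Longrightarrow> cyclic_on p S"
    and "pairwise disjnt A"
  shows "sign (perm_restrict p (\<Union>A)) = (\<Prod>S\<in>A. (-1) ^ (card S - 1))"
  using assms(2-)
proof (induction A rule: finite_induct)
  case empty
  then show ?case
    by (simp add: perm_restrict_def)
next
  case (insert S A)
  have inj: "inj_on p T" for T
    using assms(1) by (auto intro: inj_on_subset bij_is_inj permutation_bijective)
  have perm: "permutation (perm_restrict p T)" if "finite T" "p ` T = T" for T
    using perm_restrict_permutes[OF inj that(2)] that(1) permutes_imp_permutation by blast
  have "finite (\<Union>A)"
    using insert by (auto intro: finite_cyclic_on)
  moreover have "p ` \<Union>A = \<Union>A"
    unfolding image_Union by (rule SUP_cong[of _ _ _ "\<lambda>S. S", simplified])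
      (simp_all add: insert.prems(1) cyclic_on_image_eq)
  ultimately have permA: "permutation (perm_restrict p (\<Union>A))"
    by (rule perm)
  have S: "cyclic_on p S"
    using insert.prems by simp
  then have permS: "permutation (perm_restrict p S)"
    by (intro perm finite_cyclic_on cyclic_on_image_eq)
  have "\<Union>A \<inter> S = {}"
    using insert.prems(2) insert.hyps(2) by (auto simp: pairwise_insert disjnt_def)
  then have "perm_restrict p (\<Union>(insert S A)) = perm_restrict p (\<Union>A) \<circ> perm_restrict p S"
    using perm_restrict_comp S by (metis Union_insert sup_commute)
  then show ?case
    using insert permA permS assms(1) S
    by (simp add: sign_compose sign_perm_restrict_cyclic pairwise_insert del: o_apply)
qed

section \<open>Nontrivial orbits and the sign as a product over them\<close>

definition nontrivial_orbits :: "('v \<Rightarrow> 'v) \<Rightarrow> 'v set set" where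
  "nontrivial_orbits p = {orbit p v | v. p v \<noteq> v}"

lemma cyclic_on_nontrivial_orbits:
  assumes "permutation p" "S \<in> nontrivial_orbits p"
  shows "cyclic_on p S"
  using assms cyclic_on_orbit' by (auto simp: nontrivial_orbits_def)

lemma pairwise_disjnt_nontrivial_orbits:
  assumes "permutation p"
  shows "pairwise disjnt (nontrivial_orbits p)"
  unfolding pairwise_def disjnt_def
  using cyclic_on_nontrivial_orbits[OF assms] orbit_cyclic_eq3 by (metis disjoint_iff)

text \<open>A cyclic set containing a fixed point is a singleton, so one moved point forces all
  points of the orbit to move.\<close>

lemma nontrivial_orbit_no_fixpoint:
  assumes "permutation p" "S \<in> nontrivial_orbits p" "u \<in> S"
  shows "p u \<noteq> u"
proof -
  obtain v where v: "S = orbit p v" "p v \<noteq> v"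
    using assms(2) by (auto simp: nontrivial_orbits_def)
  show ?thesis
    using eq_on_cyclic_on_iff1[of p S] cyclic_on_nontrivial_orbits[OF assms(1,2)] assms(3)
      permutation_self_in_orbit[OF assms(1), of v] v by metis
qed

lemma Union_nontrivial_orbits:
  assumes "permutation p"
  shows "\<Union>(nontrivial_orbits p) = {v. p v \<noteq> v}"
proof
  show "\<Union>(nontrivial_orbits p) \<subseteq> {v. p v \<noteq> v}"
    using nontrivial_orbit_no_fixpoint[OF assms] by blast
  show "{v. p v \<noteq> v} \<subseteq> \<Union>(nontrivial_orbits p)"
    \<comment> \<open>\<open>orbit p v\<close> is generated starting from \<open>p v\<close>; that
      it contains \<open>v\<close> itself uses that \<open>p\<close> is a permutation.\<close>
    using permutation_self_in_orbit[OF assms] by (fastforce simp: nontrivial_orbits_def)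
qed

text \<open>A cyclic set is the orbit of each of its points, so a family of cyclic sets covering
  exactly the moved points must be the family of orbits. This determines the orbits after a reversal
  and those of a permutation glued from loops.\<close>

lemma nontrivial_orbits_eqI:
  assumes "\<And>S. S \<in> A \<Longrightarrow> cyclic_on p S" "\<Union>A = {v. p v \<noteq> v}"
  shows "nontrivial_orbits p = A"
proof
  show "nontrivial_orbits p \<subseteq> A"
  proof
    fix S
    assume "S \<in> nontrivial_orbits p"
    then obtain v where v: "S = orbit p v" "p v \<noteq> v"
      by (auto simp: nontrivial_orbits_def)
    then obtain T where "T \<in> A" "v \<in> T"
      using assms(2) by blast
    then show "S \<in> A"
      using assms(1) v orbit_cyclic_eq3 by metis
  qed
  show "A \<subseteq> nontrivial_orbits p"
  proof
    fix S
    assume S: "S \<in> A"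
    then obtain v where v: "v \<in> S" "S = orbit p v"
      using assms(1) by (auto simp: cyclic_on_def)
    then have "p v \<noteq> v"
      using assms(2) S by blast
    then show "S \<in> nontrivial_orbits p"
      using v by (auto simp: nontrivial_orbits_def)
  qed
qed

lemma sign_eq_prod_nontrivial_orbits:
  fixes p :: "'v::finite \<Rightarrow> 'v"
  assumes "permutation p"
  shows "sign p = (\<Prod>S\<in>nontrivial_orbits p. (-1) ^ (card S - 1))"
proof -
  have "perm_restrict p (\<Union>(nontrivial_orbits p)) = p"
    by (auto simp: Union_nontrivial_orbits[OF assms] perm_restrict_def)
  then show ?thesis
    using sign_perm_restrict_Union[OF assms _ _ pairwise_disjnt_nontrivial_orbits[OF assms]]
      cyclic_on_nontrivial_orbits[OF assms] by simp
qed

section \<open>Cancellation of odd cycles\<close>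

definition all_cycles_even :: "('v \<Rightarrow> 'v) \<Rightarrow> bool" where
  "all_cycles_even p \<longleftrightarrow> (\<forall>S\<in>nontrivial_orbits p. even (card S))"

definition reverse_on :: "'v set \<Rightarrow> ('v \<Rightarrow> 'v) \<Rightarrow> 'v \<Rightarrow> 'v" where
  "reverse_on S p v = (if v \<in> S then inv p v else p v)"

text \<open>Reversal on \<open>S\<close> amounts to composing \<open>p\<close> with the square of
  the inverse of its restriction to \<open>S\<close>. A square has sign 1, so the sign of
  \<open>p\<close> is unchanged.\<close>

lemma
  assumes p: "permutation p" and S: "cyclic_on p S"
  shows permutation_reverse_on: "permutation (reverse_on S p)"
    and sign_reverse_on: "sign (reverse_on S p) = sign p"
proof -
  let ?r = "perm_restrict p S"
  have inj: "inj p"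
    using p by (simp add: bij_is_inj permutation_bijective)
  have r: "?r permutes S"
    by (rule perm_restrict_cyclic_permutes[OF p S])
  then have perm_r: "permutation ?r"
    using S finite_cyclic_on permutation_permutes by blast
  have inv_r: "inv ?r v = (if v \<in> S then inv p v else v)" for v
  proof (cases "v \<in> S")
    case True
    then obtain u where u: "u \<in> S" "v = p u"
      using cyclic_on_image_eq[OF S] by blast
    then have "?r u = v"
      by (simp add: perm_restrict_def)
    then show ?thesis
      using u inj r True by (metis inv_f_f permutes_inj)
  next
    case False
    then show ?thesis
      using permutes_not_in[OF permutes_inv[OF r]] by simp
  qed
  have inv_p: "p (inv p v) = v" for v
    using p by (simp add: bij_is_surj permutation_bijective surj_f_inv_f)
  have "inv p v \<in> S" if "v \<in> S" for v
    using that cyclic_on_image_eq[OF S] inj by (metis imageE inv_f_f)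
  \<comment> \<open>On \<open>S\<close>, two backward steps followed by one forward step leave one
    backward step; outside \<open>S\<close> the square acts trivially.\<close>
  then have eq: "reverse_on S p = p \<circ> (inv ?r \<circ> inv ?r)"
    by (auto simp: reverse_on_def inv_r inv_p)
  show "permutation (reverse_on S p)"
    unfolding eq by (intro permutation_compose permutation_inverse p perm_r)
  show "sign (reverse_on S p) = sign p"
    unfolding eq using p perm_r by (simp add: sign_compose permutation_inverse permutation_compose)
qed

lemma reverse_on_reverse_on:
  assumes p: "permutation p" and S: "cyclic_on p S"
  shows "reverse_on S (reverse_on S p) = p"
proof
  fix v
  have "inv (reverse_on S p) v = p v" if v: "v \<in> S"
  proof -
    have "reverse_on S p (p v) = v"
      using v cyclic_on_inI[OF S] p
      by (simp add: reverse_on_def bij_is_inj permutation_bijective)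
    then show ?thesis
      using permutation_reverse_on[OF p S] by (metis bij_inv_eq_iff permutation_bijective)
  qed
  then show "reverse_on S (reverse_on S p) v = p v"
    by (simp add: reverse_on_def)
qed

lemma cyclic_on_reverse_on:
  assumes p: "permutation p" and S: "cyclic_on p S" and T: "cyclic_on p T"
  shows "cyclic_on (reverse_on S p) T"
proof (cases "T = S")
  case True
  have "cyclic_on (inv p) S"
    using S orbit_inv_eq[OF p] by (simp add: cyclic_on_def)
  then show ?thesis
    using True cyclic_cong[of S "reverse_on S p" "inv p"] by (simp add: reverse_on_def)
next
  case False
  then have "T \<inter> S = {}"
    using orbit_cyclic_eq3[OF S] orbit_cyclic_eq3[OF T] by blast
  then show ?thesis
    using T cyclic_cong[of T "reverse_on S p" p] by (simp add: reverse_on_def disjoint_iff)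
qed

lemma nontrivial_orbits_reverse_on:
  assumes p: "permutation p" and S: "cyclic_on p S"
  shows "nontrivial_orbits (reverse_on S p) = nontrivial_orbits p"
proof (rule nontrivial_orbits_eqI)
  show "cyclic_on (reverse_on S p) T" if "T \<in> nontrivial_orbits p" for T
    by (intro cyclic_on_reverse_on p S cyclic_on_nontrivial_orbits that)
  have "inv p v = v \<longleftrightarrow> p v = v" for v
    using p by (metis bij_inv_eq_iff permutation_bijective)
  then show "\<Union> (nontrivial_orbits p) = {v. reverse_on S p v \<noteq> v}"
    by (auto simp: Union_nontrivial_orbits[OF p] reverse_on_def)
qed

text \<open>If reversal changed nothing, \<open>p\<close> would agree with its inverse on the orbit,
  so two steps would return to the start and the orbit would have exactly two points.\<close>

lemma reverse_on_neq:
  assumes p: "permutation p" and S: "S \<in> nontrivial_orbits p" and odd: "odd (card S)"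
  shows "reverse_on S p \<noteq> p"
proof
  assume eq: "reverse_on S p = p"
  obtain v where v: "S = orbit p v" "p v \<noteq> v"
    using S by (auto simp: nontrivial_orbits_def)
  then have "v \<in> S"
    using permutation_self_in_orbit[OF p] by simp
  then have "p v = inv p v"
    using fun_cong[OF eq, of v] by (simp add: reverse_on_def)
  then have "(p ^^ 2) v = v"
    using p by (simp add: numeral_2_eq_2 bij_is_surj permutation_bijective surj_f_inv_f)
  then have "S = {(p ^^ m) v | m. m < 2}"
    using v(1) orbit_altdef_bounded[of 2 p v] by simp
  also have "\<dots> = {v, p v}"
    by (force simp: less_2_cases_iff)
  finally have "card S = 2"
    using v(2) by simp
  then show False
    using odd by simp
qed

text \<open>Reindexing along \<open>p\<close> turns each factor \<open>K v (inv p v)\<close> on the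
  orbit into \<open>K (p v) v\<close>. Skew-symmetry then yields one factor -1 per vertex of the
  orbit, an odd number of them.\<close>

lemma prod_reverse_on:
  fixes K :: "'v::finite \<Rightarrow> 'v \<Rightarrow> 'a::comm_ring_1"
  assumes p: "permutation p" and S: "S \<in> nontrivial_orbits p" and odd: "odd (card S)"
    and skew: "\<And>u v. u \<noteq> v \<Longrightarrow> K v u = - K u v"
  shows "(\<Prod>v\<in>UNIV. K v (reverse_on S p v)) = - (\<Prod>v\<in>UNIV. K v (p v))"
proof -
  note cyc = cyclic_on_nontrivial_orbits[OF p S]
  have inj: "inj p"
    using p by (simp add: bij_is_inj permutation_bijective)
  have split: "(\<Prod>v\<in>UNIV. f v) = (\<Prod>v\<in>S. f v) * (\<Prod>v\<in>-S. f v)" for f :: "'v \<Rightarrow> 'a"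
    using prod.union_disjoint[of S "-S" f] by (simp add: Compl_partition)
  have "(\<Prod>v\<in>S. K v (reverse_on S p v)) = (\<Prod>v\<in>p ` S. K v (inv p v))"
    by (simp add: cyclic_on_image_eq[OF cyc] reverse_on_def)
  also have "\<dots> = (\<Prod>v\<in>S. K (p v) v)"
    using inj by (subst prod.reindex) (auto intro: inj_on_subset)
  also have "\<dots> = (\<Prod>v\<in>S. - K v (p v))"
    using nontrivial_orbit_no_fixpoint[OF p S] by (intro prod.cong refl skew) metis
  also have "\<dots> = - (\<Prod>v\<in>S. K v (p v))"
    using odd by (simp add: prod_uminus)
  finally show ?thesis
    unfolding split by (simp add: reverse_on_def)
qed

text \<open>Skew-symmetry is assumed off the diagonal only, which leaves the vertex weights free:
  fixed points belong to no nontrivial orbit and are never reversed.\<close>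

lemma det_eq_sum_all_cycles_even:
  fixes K :: "'a::comm_ring_1 ^ 'v ^ 'v"
  assumes skew: "\<And>u v. u \<noteq> v \<Longrightarrow> K $ v $ u = - K $ u $ v"
  shows "det K = (\<Sum>p | permutation p \<and> all_cycles_even p. of_int (sign p) * (\<Prod>v\<in>UNIV. K $ v $ p v))"
proof -
  let ?t = "\<lambda>p. of_int (sign p) * (\<Prod>v\<in>UNIV. K $ v $ p v)"
  let ?odd = "{p :: 'v \<Rightarrow> 'v. permutation p \<and> \<not> all_cycles_even p}"
  define c where "c p = (SOME S. S \<in> nontrivial_orbits p \<and> odd (card S))" for p :: "'v \<Rightarrow> 'v"
  have c: "permutation p \<and> c p \<in> nontrivial_orbits p \<and> odd (card (c p)) \<and> cyclic_on p (c p)"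
    if "p \<in> ?odd" for p
  proof -
    have "\<exists>S. S \<in> nontrivial_orbits p \<and> odd (card S)"
      using that by (auto simp: all_cycles_even_def)
    from someI_ex[OF this] show ?thesis
      using that cyclic_on_nontrivial_orbits unfolding c_def by blast
  qed
  have zero: "(\<Sum>p\<in>?odd. ?t p) = 0"
  proof (rule sum_involution_eq_0[where h = "\<lambda>p. reverse_on (c p) p"])
    fix p
    assume p: "p \<in> ?odd"
    have orb: "nontrivial_orbits (reverse_on (c p) p) = nontrivial_orbits p"
      using c[OF p] by (intro nontrivial_orbits_reverse_on) auto
    show "reverse_on (c p) p \<in> ?odd"
      using c[OF p] p orb by (auto simp: all_cycles_even_def permutation_reverse_on)
    \<comment> \<open>the cycle chosen by \<^term>\<open>c\<close> depends only on the orbits, which reversal preserves\<close>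
    have "c (reverse_on (c p) p) = c p"
      unfolding c_def[of "reverse_on (c p) p"] c_def[of p, symmetric] orb ..
    then show "reverse_on (c (reverse_on (c p) p)) (reverse_on (c p) p) = p"
      using c[OF p] by (simp add: reverse_on_reverse_on)
    \<comment> \<open>The pairing must have no fixed points: in an arbitrary commutative ring a term
      whose double is 0 need not vanish.\<close>
    show "reverse_on (c p) p \<noteq> p"
      using c[OF p] reverse_on_neq by blast
    have "(\<Prod>v\<in>UNIV. K $ v $ reverse_on (c p) p v) = - (\<Prod>v\<in>UNIV. K $ v $ p v)"
      using c[OF p] by (intro prod_reverse_on[of p "c p" "\<lambda>u v. K $ u $ v"] skew) auto
    then show "?t (reverse_on (c p) p) + ?t p = 0"
      using c[OF p] by (simp add: sign_reverse_on)
  qed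
  have perm: "p permutes UNIV \<longleftrightarrow> permutation p" for p :: "'v \<Rightarrow> 'v"
    using permutes_imp_permutation[of UNIV p] bij_imp_permutes[of p UNIV] permutation_bijective[of p]
    by fastforce
  have "det K = (\<Sum>p | permutation p. ?t p)"
    by (simp add: det_def perm)
  also have "\<dots> = (\<Sum>p\<in>{p. permutation p \<and> all_cycles_even p} \<union> ?odd. ?t p)"
    by (rule sum.cong) auto
  also have "\<dots> = (\<Sum>p | permutation p \<and> all_cycles_even p. ?t p) + (\<Sum>p\<in>?odd. ?t p)"
    by (rule sum.union_disjoint) auto
  finally show ?thesis
    using zero by simp
qed

section \<open>Loop-vertex configurations as permutations\<close>

text \<open>The graph of \<open>p\<close> over \<open>S\<close>. Each vertex is the tail of exactly
  one arc, so products over arcs become products over vertices.\<close>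

definition arcs_on :: "('v \<Rightarrow> 'v) \<Rightarrow> 'v set \<Rightarrow> ('v \<times> 'v) set" where
  "arcs_on p S = (\<lambda>v. (v, p v)) ` S"

lemma prod_arcs_on: "(\<Prod>(u, v)\<in>arcs_on p S. f u v) = (\<Prod>v\<in>S. f v (p v))"
  unfolding arcs_on_def by (subst prod.reindex) (auto simp: inj_on_def)

lemma Field_arcs_on:
  assumes "cyclic_on p S"
  shows "Field (arcs_on p S) = S"
  using cyclic_on_image_eq[OF assms] by (auto simp: arcs_on_def Field_def)

lemma loop_arcs_eq_arcs_on:
  assumes "distinct vs"
  shows "loop_arcs vs = arcs_on (cycle_of_list vs) (set vs)"
proof -
  have "arcs_on (cycle_of_list vs) (set vs)
      = (\<lambda>j. (vs ! j, cycle_of_list vs (vs ! j))) ` {..<length vs}"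
    by (force simp: arcs_on_def in_set_conv_nth)
  also have "\<dots> = (\<lambda>j. (vs ! j, vs ! (Suc j mod length vs))) ` {..<length vs}"
    by (intro image_cong refl) (simp add: cycle_of_list_nth[OF assms])
  finally show ?thesis
    by (auto simp: loop_arcs_def)
qed

text \<open>Replaces the vertex sequence by the cyclic permutation it traces, which removes the
  choice of a starting vertex and puts loops in the form of orbits.\<close>

lemma even_directed_loop_iff:
  "even_directed_loop E l \<longleftrightarrow>
    (\<exists>c S. c permutes S \<and> cyclic_on c S \<and> even (card S) \<and> (\<forall>u\<in>S. {u, c u} \<in> E) \<and> l = arcs_on c S)"
proof
  assume "even_directed_loop E l"
  then obtain vs where vs: "distinct vs" "even (length vs)" "length vs \<ge> 2" "l = loop_arcs vs"
    and E: "\<And>j. j < length vs \<Longrightarrow> {vs ! j, vs ! (Suc j mod length vs)} \<in> E"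
    by (auto simp: even_directed_loop_def)
  have "{u, cycle_of_list vs u} \<in> E" if "u \<in> set vs" for u
    using that E cycle_of_list_nth[OF vs(1)] by (auto simp: in_set_conv_nth)
  moreover have "vs \<noteq> []"
    using vs(3) by auto
  ultimately show "\<exists>c S. c permutes S \<and> cyclic_on c S \<and> even (card S) \<and> (\<forall>u\<in>S. {u, c u} \<in> E)
      \<and> l = arcs_on c S"
    using vs(2) distinct_card[OF vs(1)]
    by (intro exI[of _ "cycle_of_list vs"] exI[of _ "set vs"])
      (simp add: cycle_permutes cyclic_on_cycle_of_list vs(1,4) loop_arcs_eq_arcs_on)
next
  assume "\<exists>c S. c permutes S \<and> cyclic_on c S \<and> even (card S) \<and> (\<forall>u\<in>S. {u, c u} \<in> E) \<and> l = arcs_on c S"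
  then obtain c S where c: "c permutes S" "cyclic_on c S" "even (card S)" "l = arcs_on c S"
    and E: "\<And>u. u \<in> S \<Longrightarrow> {u, c u} \<in> E"
    by blast
  obtain vs where vs: "distinct vs" "set vs = S" "c = cycle_of_list vs"
    using cyclic_on_permutes_obtain_list[OF c(1,2)] .
  have len: "length vs = card S"
    using vs distinct_card by metis
  have "card S \<noteq> 0"
    using c(2) finite_cyclic_on[OF c(2)] by (auto simp: cyclic_on_def)
  \<comment> \<open>An even nonzero length is at least 2, so the lower bound comes from the
    nonemptiness of a cyclic set.\<close>
  then have "length vs \<ge> 2"
    using c(3) len by (auto elim!: evenE)
  moreover have "{vs ! j, vs ! (Suc j mod length vs)} \<in> E" if "j < length vs" for j
    using E[of "vs ! j"] that vs cycle_of_list_nth[OF vs(1) that] by auto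
  ultimately show "even_directed_loop E l"
    unfolding even_directed_loop_def
    using vs c len loop_arcs_eq_arcs_on by (intro exI[of _ vs]) auto
qed

section \<open>Bijection between configurations and even-cycled permutations along edges\<close>

definition edge_permutation :: "'v set set \<Rightarrow> ('v \<Rightarrow> 'v) \<Rightarrow> bool" where
  "edge_permutation E p \<longleftrightarrow> permutation p \<and> (\<forall>v. p v \<noteq> v \<longrightarrow> {v, p v} \<in> E)"

definition loops_of :: "('v \<Rightarrow> 'v) \<Rightarrow> ('v \<times> 'v) set set" where
  "loops_of p = arcs_on p ` nontrivial_orbits p"

lemma Union_loops_of:
  assumes "permutation p"
  shows "\<Union>(loops_of p) = {(v, p v) | v. p v \<noteq> v}"
proof -
  have "\<Union>(loops_of p) = (\<lambda>v. (v, p v)) ` \<Union>(nontrivial_orbits p)"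
    by (auto simp: loops_of_def arcs_on_def)
  then show ?thesis
    by (auto simp: Union_nontrivial_orbits[OF assms])
qed

text \<open>The union of the loops is the graph of the permutation away from its fixed points, and
  this determines the permutation.\<close>

lemma loops_of_inject:
  assumes "permutation p" "permutation q" "loops_of p = loops_of q"
  shows "p = q"
proof
  fix v
  have eq: "{(v, p v) | v. p v \<noteq> v} = {(v, q v) | v. q v \<noteq> v}"
    using Union_loops_of[OF assms(1)] Union_loops_of[OF assms(2)] assms(3) by simp
  show "p v = q v"
  proof (cases "p v = v")
    case True
    then have "(v, q v) \<notin> {(v, q v) | v. q v \<noteq> v}"
      unfolding eq[symmetric] by blast
    then have "q v = v"
      by blast
    then show ?thesis
      using True by simp
  next
    case False
    then have "(v, p v) \<in> {(v, q v) | v. q v \<noteq> v}"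
      unfolding eq[symmetric] by blast
    then show ?thesis
      by blast
  qed
qed

lemma loops_of_mem_configs:
  fixes p :: "'v::finite \<Rightarrow> 'v"
  assumes p: "edge_permutation E p" and even: "all_cycles_even p"
  shows "loops_of p \<in> loop_vertex_configs E"
proof -
  have perm: "permutation p"
    using p by (simp add: edge_permutation_def)
  note cyc = cyclic_on_nontrivial_orbits[OF perm]
  have "even_directed_loop E (arcs_on p S)" if S: "S \<in> nontrivial_orbits p" for S
    unfolding even_directed_loop_iff
  proof (intro exI conjI ballI)
    \<comment> \<open>The characterisation of loops asks for a permutation that is trivial outside
      \<open>S\<close>, hence the restriction of \<open>p\<close> as witness.\<close>
    show "perm_restrict p S permutes S"
      by (rule perm_restrict_cyclic_permutes[OF perm cyc[OF S]])
    show "cyclic_on (perm_restrict p S) S"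
      using cyc[OF S] by (simp add: cyclic_on_perm_restrict)
    show "even (card S)"
      using even S by (simp add: all_cycles_even_def)
    show "{u, perm_restrict p S u} \<in> E" if "u \<in> S" for u
      using nontrivial_orbit_no_fixpoint[OF perm S that] p that
      by (simp add: edge_permutation_def perm_restrict_def)
    show "arcs_on p S = arcs_on (perm_restrict p S) S"
      by (simp add: arcs_on_def perm_restrict_def)
  qed
  moreover have "pairwise (\<lambda>l m. disjnt (Field l) (Field m)) (loops_of p)"
    using pairwise_disjnt_nontrivial_orbits[OF perm]
    by (auto simp: loops_of_def pairwise_def Field_arcs_on cyc)
  ultimately show ?thesis
    by (auto simp: loop_vertex_configs_def loops_of_def)
qed

text \<open>The permutation is glued together: on each loop it follows the arcs of that loop, and it
  fixes the isolated vertices.\<close>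

lemma loop_vertex_config_obtain_permutation:
  fixes E :: "'v::finite set set"
  assumes E: "simple_graph E" and C: "C \<in> loop_vertex_configs E"
  obtains p where "edge_permutation E p" "all_cycles_even p" "loops_of p = C"
proof -
  have "\<forall>l\<in>C. \<exists>c. cyclic_on c (Field l) \<and> even (card (Field l)) \<and>
      (\<forall>u\<in>Field l. {u, c u} \<in> E) \<and> l = arcs_on c (Field l)"
  proof
    fix l
    assume "l \<in> C"
    then have "even_directed_loop E l"
      using C by (simp add: loop_vertex_configs_def)
    then obtain c S where "cyclic_on c S" "even (card S)" "\<forall>u\<in>S. {u, c u} \<in> E" "l = arcs_on c S"
      unfolding even_directed_loop_iff by blast
    then show "\<exists>c. cyclic_on c (Field l) \<and> even (card (Field l)) \<and>
        (\<forall>u\<in>Field l. {u, c u} \<in> E) \<and> l = arcs_on c (Field l)"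
      using Field_arcs_on by metis
  qed
  then obtain c where c: "\<And>l. l \<in> C \<Longrightarrow> cyclic_on (c l) (Field l)"
    "\<And>l. l \<in> C \<Longrightarrow> even (card (Field l))"
    "\<And>l u. l \<in> C \<Longrightarrow> u \<in> Field l \<Longrightarrow> {u, c l u} \<in> E"
    "\<And>l. l \<in> C \<Longrightarrow> l = arcs_on (c l) (Field l)"
    unfolding bchoice_iff by blast
  have uniq: "l = m" if "l \<in> C" "m \<in> C" "v \<in> Field l" "v \<in> Field m" for l m v
    using C that by (auto simp: loop_vertex_configs_def pairwise_def disjnt_def)
  \<comment> \<open>Vertex-disjointness makes the loop through \<open>v\<close> unique, so the
    definite description is meaningful wherever it is used.\<close>
  define p where "p v = (if \<exists>l\<in>C. v \<in> Field l then c (THE l. l \<in> C \<and> v \<in> Field l) v else v)" for v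
  have p: "p v = c l v" if "l \<in> C" "v \<in> Field l" for l v
  proof -
    have "(THE l. l \<in> C \<and> v \<in> Field l) = l"
      using that uniq by (intro the_equality) auto
    moreover have "\<exists>l\<in>C. v \<in> Field l"
      using that by blast
    ultimately show ?thesis
      by (simp add: p_def)
  qed
  have p_out: "p v = v" if "v \<notin> \<Union>(Field ` C)" for v
    using that by (auto simp: p_def)
  have cyc: "cyclic_on p (Field l)" if "l \<in> C" for l
    using c(1)[OF that] p[OF that] cyclic_cong[of "Field l" p "c l"] by simp
  \<comment> \<open>On a finite type surjectivity suffices for bijectivity; each loop is mapped onto
    itself.\<close>
  have "surj p"
    unfolding surj_def
  proof
    fix v
    show "\<exists>u. v = p u"
    proof (cases "v \<in> \<Union>(Field ` C)")
      case True
      then obtain l where "l \<in> C" "v \<in> Field l"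
        by blast
      then have "v \<in> p ` Field l"
        using cyclic_on_image_eq[OF cyc] by simp
      then show ?thesis
        by blast
    next
      case False
      then show ?thesis
        using p_out[OF False] by (intro exI[of _ v]) simp
    qed
  qed
  then have perm: "permutation p"
    by (simp add: permutation finite_UNIV_surj_inj bij_def)
  have edge: "{v, p v} \<in> E" if "l \<in> C" "v \<in> Field l" for l v
    using p c(3) that by simp
  \<comment> \<open>An edge has two endpoints, so \<open>{v, p v}\<close> being an edge excludes
    \<open>p v = v\<close>. Hence the moved vertices are exactly those lying on loops.\<close>
  have "p v \<noteq> v" if "l \<in> C" "v \<in> Field l" for l v
    using edge[OF that] E by (auto simp: simple_graph_def)
  then have moved: "(\<Union>l\<in>C. Field l) = {v. p v \<noteq> v}"
    using p_out by blast
  then have orbs: "nontrivial_orbits p = Field ` C"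
    using cyc by (intro nontrivial_orbits_eqI) auto
  show thesis
  proof
    show "edge_permutation E p"
      using perm edge p_out unfolding edge_permutation_def by blast
    show "all_cycles_even p"
      using c(2) by (auto simp: all_cycles_even_def orbs)
    have "arcs_on p (Field l) = arcs_on (c l) (Field l)" if "l \<in> C" for l
      unfolding arcs_on_def using p[OF that] by (intro image_cong) auto
    then have "arcs_on p (Field l) = l" if "l \<in> C" for l
      using c(4) that by metis
    then show "loops_of p = C"
      by (simp add: loops_of_def orbs image_image)
  qed
qed

lemma bij_betw_loops_of:
  fixes E :: "'v::finite set set"
  assumes "simple_graph E"
  shows "bij_betw loops_of {p. edge_permutation E p \<and> all_cycles_even p} (loop_vertex_configs E)"
  unfolding bij_betw_def
proof
  show "inj_on loops_of {p. edge_permutation E p \<and> all_cycles_even p}"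
    by (auto simp: inj_on_def edge_permutation_def intro: loops_of_inject)
  show "loops_of ` {p. edge_permutation E p \<and> all_cycles_even p} = loop_vertex_configs E"
    using loops_of_mem_configs loop_vertex_config_obtain_permutation[OF assms] by blast
qed

section \<open>Comparison of weights\<close>

lemma signed_adjacency_matrix_arc:
  assumes "orientation E D" "{u, v} \<in> E" "u \<noteq> v"
  shows "signed_adjacency_matrix E D x a $ u $ v = arc_sgn D u v * a u v"
proof -
  \<comment> \<open>Exactly one of the two directions of an edge is chosen, so the -1 branch of
    \<open>arc_sgn\<close> coincides with the negative branch of the matrix.\<close>
  have "(u, v) \<in> D \<longleftrightarrow> (v, u) \<notin> D"
    using assms(1,2) unfolding orientation_def by blast
  then show ?thesis
    using assms(2,3) by (simp add: signed_adjacency_matrix_def arc_sgn_def)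
qed

lemma config_weight_loops_of:
  fixes p :: "'v::finite \<Rightarrow> 'v" and a :: "'v \<Rightarrow> 'v \<Rightarrow> 'a::comm_ring_1"
  assumes D: "orientation E D" and p: "edge_permutation E p" and even: "all_cycles_even p"
  shows "config_weight D x a (loops_of p) =
    of_int (sign p) * (\<Prod>v\<in>UNIV. signed_adjacency_matrix E D x a $ v $ p v)"
proof -
  let ?K = "\<lambda>u v. signed_adjacency_matrix E D x a $ u $ v"
  let ?N = "nontrivial_orbits p"
  have perm: "permutation p"
    using p by (simp add: edge_permutation_def)
  note cyc = cyclic_on_nontrivial_orbits[OF perm]
  \<comment> \<open>An even orbit is nonempty, so \<open>card S - 1\<close> is a genuine odd number;
    the sign of the cycle is the minus sign in \<open>loop_weight\<close>.\<close>
  have sgn: "of_int ((-1) ^ (card S - 1)) = (-1 :: 'a)" if S: "S \<in> ?N" for S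
  proof -
    have "card S \<noteq> 0"
      using cyc[OF S] by (auto simp: cyclic_on_def)
    then have "odd (card S - 1)"
      using even S by (simp add: all_cycles_even_def)
    then show ?thesis
      by simp
  qed
  have weight: "loop_weight D a (arcs_on p S) = of_int ((-1) ^ (card S - 1)) * (\<Prod>v\<in>S. ?K v (p v))"
    if S: "S \<in> ?N" for S
  proof -
    have "(\<Prod>v\<in>S. arc_sgn D v (p v) * a v (p v)) = (\<Prod>v\<in>S. ?K v (p v))"
      using nontrivial_orbit_no_fixpoint[OF perm S] p
      by (intro prod.cong refl signed_adjacency_matrix_arc[OF D, symmetric])
        (metis edge_permutation_def)+
    then show ?thesis
      by (simp only: loop_weight_def prod_arcs_on sgn[OF S]) simp
  qed
  \<comment> \<open>An orbit is recovered from its loop as the \<open>Field\<close>, so the product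
    over loops can be reindexed by orbits.\<close>
  have "inj_on (arcs_on p) ?N"
    using Field_arcs_on cyc by (metis inj_onI)
  then have "(\<Prod>l\<in>loops_of p. loop_weight D a l) = (\<Prod>S\<in>?N. loop_weight D a (arcs_on p S))"
    by (simp add: loops_of_def prod.reindex)
  also have "\<dots> = of_int (sign p) * (\<Prod>S\<in>?N. \<Prod>v\<in>S. ?K v (p v))"
    by (simp only: weight prod.distrib sign_eq_prod_nontrivial_orbits[OF perm] of_int_prod cong: prod.cong)
  also have "(\<Prod>S\<in>?N. \<Prod>v\<in>S. ?K v (p v)) = (\<Prod>v\<in>\<Union>?N. ?K v (p v))"
    using pairwise_disjnt_nontrivial_orbits[OF perm]
    by (subst prod.Union_disjoint) (auto simp: pairwise_def disjnt_def)
  also have "\<Union>?N = {v. p v \<noteq> v}"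
    by (rule Union_nontrivial_orbits[OF perm])
  finally have loops: "(\<Prod>l\<in>loops_of p. loop_weight D a l) =
    of_int (sign p) * (\<Prod>v | p v \<noteq> v. ?K v (p v))" .
  have "(\<Union>l\<in>loops_of p. Field l) = \<Union>?N"
    by (simp add: loops_of_def Field_arcs_on cyc)
  then have "isolated_vertices (loops_of p) = {v. p v = v}"
    by (auto simp: isolated_vertices_def Union_nontrivial_orbits[OF perm])
  \<comment> \<open>Isolated vertices are the fixed points, where the matrix entry is the diagonal
    one.\<close>
  then have isolated: "(\<Prod>v\<in>isolated_vertices (loops_of p). x v) = (\<Prod>v | p v = v. ?K v (p v))"
    by (simp add: signed_adjacency_matrix_def)
  have "(\<Prod>v\<in>UNIV. ?K v (p v)) = (\<Prod>v\<in>{v. p v \<noteq> v} \<union> {v. p v = v}. ?K v (p v))"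
    by (rule prod.cong) auto
  also have "\<dots> = (\<Prod>v | p v \<noteq> v. ?K v (p v)) * (\<Prod>v | p v = v. ?K v (p v))"
    by (rule prod.union_disjoint) auto
  finally show ?thesis
    by (simp add: config_weight_def loops isolated mult.assoc)
qed

theorem theorem2p5:
  fixes E :: "'v::finite set set"
    and D :: "('v \<times> 'v) set"
    and x :: "'v \<Rightarrow> 'a::comm_ring_1"
    and a :: "'v \<Rightarrow> 'v \<Rightarrow> 'a"
  assumes "simple_graph E"
    and "orientation E D"
    and "\<And>u v. {u, v} \<in> E \<Longrightarrow> a u v = a v u"
  shows "signed_partition_function E D x a = det (signed_adjacency_matrix E D x a)"
proof -
  let ?K = "signed_adjacency_matrix E D x a"
  let ?t = "\<lambda>p. of_int (sign p) * (\<Prod>v\<in>UNIV. ?K $ v $ p v)"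
  have "signed_partition_function E D x a
      = (\<Sum>p | edge_permutation E p \<and> all_cycles_even p. config_weight D x a (loops_of p))"
    unfolding signed_partition_function_def
    by (rule sum.reindex_bij_betw[OF bij_betw_loops_of[OF assms(1)], symmetric])
  also have "\<dots> = (\<Sum>p | edge_permutation E p \<and> all_cycles_even p. ?t p)"
    by (intro sum.cong refl config_weight_loops_of assms(2)) auto
  \<comment> \<open>The sum is enlarged by permutations that move some vertex to a non-neighbour;
    each such term contains a zero entry of the matrix.\<close>
  also have "\<dots> = (\<Sum>p | permutation p \<and> all_cycles_even p. ?t p)"
  proof (intro sum.mono_neutral_left ballI)
    fix p
    assume "p \<in> {p. permutation p \<and> all_cycles_even p} - {p. edge_permutation E p \<and> all_cycles_even p}"
    then obtain v where "p v \<noteq> v" "{v, p v} \<notin> E"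
      by (auto simp: edge_permutation_def)
    then have "?K $ v $ p v = 0"
      by (auto simp: signed_adjacency_matrix_def)
    then have "(\<Prod>v\<in>UNIV. ?K $ v $ p v) = 0"
      by (intro prod_zero) auto
    then show "?t p = 0"
      by simp
  qed (auto simp: edge_permutation_def)
  also have "\<dots> = det ?K"
  \<comment> \<open>Off the diagonal the matrix is skew: exchanging the endpoints of an edge flips
    the orientation sign while the symmetric weight \<open>a\<close> stays the same.\<close>
  proof (rule det_eq_sum_all_cycles_even[symmetric])
    fix u v :: 'v
    assume "u \<noteq> v"
    have swap: "{v, u} = {u, v}"
      by blast
    show "?K $ v $ u = - ?K $ u $ v"
    proof (cases "{u, v} \<in> E")
      case True
      then have "(u, v) \<in> D \<longleftrightarrow> (v, u) \<notin> D"
        using assms(2) unfolding orientation_def by blast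
      then show ?thesis
        using True \<open>u \<noteq> v\<close> assms(3)[OF True]
        by (simp add: signed_adjacency_matrix_def swap)
    next
      case False
      then show ?thesis
        using \<open>u \<noteq> v\<close> by (simp add: signed_adjacency_matrix_def swap)
    qed
  qed
  finally show ?thesis .
qed

end
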